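(* For every positive integer $m$ and every positive even integer $n$, $D_m(n)<n$.
   Context: For $m,n\in\mathbb{N}$, the Schemmel totient function $L_m(n)$ is the number of integers $k\in\{1,\dots,n\}$ such that $\gcd(k+s,n)=1$ for all $s\in\{0,1,\dots,m-1\}$ (so $L_1$ is Euler's $\phi$); by convention $L_m(0)=0$. Equivalently, $L_m(1)=1$, and for $n>1$ with $n=\prod_{i=1}^r p_i^{\alpha_i}$, $L_m(n)=0$ if the smallest prime factor of $n$ is $\le m$, and $L_m(n)=\prod_{i} p_i^{\alpha_i-1}(p_i-m)$ otherwise. Iterates: $f^{(1)}=f$, $f^{(k+1)}=f\circ f^{(k)}$. $R_m(n)$ is the least positive integer $k$ with $L_m^{(k)}(n)\in\{0,1\}$. Define $D_m(1)=0$ and $D_m(n)=\sum_{i=1}^{R_m(n)}L_m^{(i)}(n)$ for $n>1$. *)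

theory Defs
  imports Complex_Main
begin

(* The convention L_m(0) = 0 comes out automatically, since {1..0} is empty. *)
definition schemmel :: "nat \<Rightarrow> nat \<Rightarrow> nat" where
  "schemmel m n = card {k \<in> {1..n}. \<forall>s<m. gcd (k + s) n = 1}"

(* For m \<ge> 1 the LEAST is taken over a nonempty set: k = n is never counted when n > 1,
   so schemmel m n < n for n > 1 and the iterates reach {0, 1}. For m = 0 (where schemmel 0 n = n)
   the value is meaningless. *)
definition schemmel_R :: "nat \<Rightarrow> nat \<Rightarrow> nat" where
  "schemmel_R m n = (LEAST k. 0 < k \<and> (schemmel m ^^ k) n \<in> {0, 1})"

(* D_m is only of interest for n \<ge> 1; at n = 0 the sum is 0. *)
definition schemmel_D :: "nat \<Rightarrow> nat \<Rightarrow> nat" where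
  "schemmel_D m n = (if n = 1 then 0 else (\<Sum>i=1..schemmel_R m n. (schemmel m ^^ i) n))"

end

theory Submission
  imports Defs "HOL-Number_Theory.Totient"
begin

text \<open>
  If \<^term>\<open>m \<ge> 2\<close>, one of \<^term>\<open>k\<close> and \<^term>\<open>k + 1\<close> shares the factor 2 with the even number
  \<^term>\<open>n\<close>, so every iterate vanishes. If \<^term>\<open>m = 1\<close>, the function is Euler's totient, which at
  least halves every even number and is again even until it reaches 1; so the iterates sum to
  less than n/2 + n/4 + ... = n.
\<close>

lemma schemmel_1_eq_totient: "schemmel 1 = totient"
proof
  fix n :: nat
  have "{k \<in> {1..n}. \<forall>s<1. gcd (k + s) n = 1} = totatives n"
    by (auto simp: totatives_def coprime_iff_gcd_eq_1)
  then show "schemmel 1 n = totient n"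
    by (simp only: schemmel_def totient_def)
qed

lemma schemmel_even_eq_0:
  assumes "m \<ge> 2" and "even n"
  shows "schemmel m n = 0"
proof -
  have "\<exists>s<m. gcd (k + s) n \<noteq> 1" for k
  proof -
    obtain s :: nat where "s < 2" and "even (k + s)"
      by (cases "even k") (force intro: that[of 0], force intro: that[of 1])
    with assms have "2 dvd gcd (k + s) n" "s < m" by auto
    then show ?thesis by (metis odd_one)
  qed
  then show ?thesis by (auto simp: schemmel_def)
qed

lemma schemmel_iterate_even_eq_0:
  assumes "m \<ge> 2" and "even n" and "i > 0"
  shows "(schemmel m ^^ i) n = 0"
  using \<open>i > 0\<close>
proof (induction i)
  case (Suc i)
  then show ?case using assms by (cases i) (simp_all add: schemmel_even_eq_0)
qed simp

text \<open>Writing n = 2k, \<open>totient n\<close> is \<open>2 * totient k\<close> for even k and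
  \<open>totient k\<close> for odd k. The first case recurses on k; the second needs only
  \<open>totient k \<le> k\<close>.\<close>

lemma two_totient_le_even:
  assumes "even n"
  shows "2 * totient n \<le> n"
  using assms
proof (induction n rule: less_induct)
  case (less n)
  then obtain k where n: "n = 2 * k" by blast
  show ?case
  \<comment> \<open>Positivity of k ensures k < n for the induction hypothesis.\<close>
  proof (cases "even k \<and> k > 0")
    case True
    then show ?thesis using less.IH[of k] by (simp add: n totient_double)
  next
    case False
    then show ?thesis using totient_le[of k] by (auto simp: n totient_double)
  qed
qed

text \<open>The bound on the iterates keeps the orbit from staying at the fixed point 1.\<close>
lemma sum_totient_iterates_less:
  assumes "even n" and "n > 0" and "\<And>i. 0 < i \<Longrightarrow> i < r \<Longrightarrow> (totient ^^ i) n > 1"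
  shows "(\<Sum>i=1..r. (totient ^^ i) n) < n"
  using assms
proof (induction r arbitrary: n)
  case (Suc r)
  have "(\<Sum>i=1..Suc r. (totient ^^ i) n) = totient n + (\<Sum>i=1..r. (totient ^^ Suc i) n)"
    by (subst sum.atLeast_Suc_atMost)
       (simp_all only: sum.atLeast_Suc_atMost_Suc_shift, simp_all add: atLeastSucAtMost_greaterThanAtMost)
  also have "\<dots> = totient n + (\<Sum>i=1..r. (totient ^^ i) (totient n))"
    by (simp add: funpow_swap1)
  also have "\<dots> < n"
  \<comment> \<open>For \<open>r = 0\<close> only \<open>totient n\<close> remains, possibly the odd
    number 1, to which the induction hypothesis could not apply.\<close>
  proof (cases "r = 0")
    case True
    then show ?thesis using two_totient_le_even[of n] Suc.prems by simp
  next
    case False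
    then have "totient n > 1" using Suc.prems(3)[of 1] by simp
    then have "n > 2" using two_totient_le_even[of n] Suc.prems by simp
    have "(\<Sum>i=1..r. (totient ^^ i) (totient n)) < totient n"
    proof (rule Suc.IH)
      show "even (totient n)" using \<open>n > 2\<close> by (rule totient_even)
      show "(totient ^^ i) (totient n) > 1" if "0 < i" "i < r" for i
        using Suc.prems(3)[of "Suc i"] that by (simp add: funpow_swap1)
    qed (use \<open>n > 2\<close> in simp)
    \<comment> \<open>The tail is below \<open>totient n\<close>, so the whole sum is below
      \<open>2 * totient n \<le> n\<close>.\<close>
    then show ?thesis using two_totient_le_even[OF Suc.prems(1)] by simp
  qed
  finally show ?case .
qed simp

theorem theorem2p2:
  fixes m n :: nat
  assumes "m > 0" and "n > 0" and "even n"
  shows "schemmel_D m n < n"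
proof (cases "m = 1")
  case True
  have "(totient ^^ i) n > 1" if "0 < i" "i < schemmel_R m n" for i
  proof -
    \<comment> \<open>Minimality of \<open>schemmel_R m n\<close> excludes 0 and 1 at earlier
      positive indices.\<close>
    have "(schemmel m ^^ i) n \<notin> {0, 1}"
      using not_less_Least[OF that(2)[unfolded schemmel_R_def]] that(1) by blast
    then show ?thesis by (simp add: True schemmel_1_eq_totient[simplified])
  qed
  then have "(\<Sum>i=1..schemmel_R m n. (totient ^^ i) n) < n"
    using assms by (intro sum_totient_iterates_less)
  then show ?thesis
    using assms by (simp add: schemmel_D_def True schemmel_1_eq_totient[simplified])
next
  case False
  with assms have "m \<ge> 2" by simp
  with assms show ?thesis
    by (simp add: schemmel_D_def schemmel_iterate_even_eq_0)
qed

end
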